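(* Let $\mathcal{H}$ be a complex Hilbert space, let $T,S$ be $EP$ operators on $\mathcal{H}$ and let $A\in\mathcal{B}(\mathcal{H})$. If $AT=SA$, then $AT^\dagger=S^\dagger A$.
   Context: $\mathcal{B}(\mathcal{H})$ is the space of bounded linear operators on $\mathcal{H}$; $\mathcal{R}(T)$ denotes the range of $T$ and $T^*$ its adjoint. For $T\in\mathcal{B}(\mathcal{H})$ with closed range, the Moore-Penrose inverse $T^\dagger$ is the unique operator in $\mathcal{B}(\mathcal{H})$ satisfying $TT^\dagger T=T$, $T^\dagger TT^\dagger=T^\dagger$, $TT^\dagger=(TT^\dagger)^*$ and $T^\dagger T=(T^\dagger T)^*$. An $EP$ operator on $\mathcal{H}$ is a $T\in\mathcal{B}(\mathcal{H})$ with closed range such that $\mathcal{R}(T)=\mathcal{R}(T^* )$. *)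

theory Defs
  imports "HOL-Analysis.Analysis"
begin

class complex_vector = real_vector +
  fixes scaleC :: "complex \<Rightarrow> 'a \<Rightarrow> 'a" (infixr \<open>*\<^sub>C\<close> 75)
  assumes scaleC_add_right: "a *\<^sub>C (x + y) = a *\<^sub>C x + a *\<^sub>C y"
    and scaleC_add_left: "(a + b) *\<^sub>C x = a *\<^sub>C x + b *\<^sub>C x"
    and scaleC_scaleC: "a *\<^sub>C (b *\<^sub>C x) = (a * b) *\<^sub>C x"
    and scaleC_one: "1 *\<^sub>C x = x"
    and scaleR_scaleC: "r *\<^sub>R x = complex_of_real r *\<^sub>C x"

text \<open>The inner product is linear in the first argument and conjugate-linear in the second.\<close>

class complex_inner = complex_vector + real_normed_vector +
  fixes cinner :: "'a \<Rightarrow> 'a \<Rightarrow> complex"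
  assumes cinner_commute: "cinner x y = cnj (cinner y x)"
    and cinner_add_left: "cinner (x + y) z = cinner x z + cinner y z"
    and cinner_scaleC_left: "cinner (a *\<^sub>C x) y = a * cinner x y"
    and cinner_ge_zero: "0 \<le> Re (cinner x x)"
    and cinner_eq_zero_iff: "cinner x x = 0 \<longleftrightarrow> x = 0"
    and norm_eq_sqrt_cinner: "norm x = sqrt (Re (cinner x x))"

class chilbert_space = complex_inner + complete_space

locale bounded_clinear = bounded_linear f
  for f :: "'a::complex_inner \<Rightarrow> 'b::complex_inner" +
  assumes scaleC: "f (c *\<^sub>C x) = c *\<^sub>C f x"

text \<open>Defined by \<open>THE\<close>: at most one function satisfies the condition, and by the Riesz
  representation theorem one exists for every bounded operator on a Hilbert space.\<close>

definition cadjoint :: "('a::chilbert_space \<Rightarrow> 'a) \<Rightarrow> 'a \<Rightarrow> 'a" where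
  "cadjoint T = (THE T'. \<forall>x y. cinner (T x) y = cinner x (T' y))"

definition is_mp_inverse :: "('a::chilbert_space \<Rightarrow> 'a) \<Rightarrow> ('a \<Rightarrow> 'a) \<Rightarrow> bool" where
  "is_mp_inverse T X \<longleftrightarrow> bounded_clinear X \<and>
     T \<circ> X \<circ> T = T \<and> X \<circ> T \<circ> X = X \<and>
     T \<circ> X = cadjoint (T \<circ> X) \<and> X \<circ> T = cadjoint (X \<circ> T)"

text \<open>Meaningful for bounded operators with closed range only; these have exactly one
  Moore-Penrose inverse.\<close>

definition mp_inverse :: "('a::chilbert_space \<Rightarrow> 'a) \<Rightarrow> 'a \<Rightarrow> 'a" where
  "mp_inverse T = (THE X. is_mp_inverse T X)"

definition EP_operator :: "('a::chilbert_space \<Rightarrow> 'a) \<Rightarrow> bool" where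
  "EP_operator T \<longleftrightarrow> bounded_clinear T \<and> closed (range T) \<and> range T = range (cadjoint T)"

end

theory Submission
  imports Defs
begin

text \<open>For an EP operator \<open>T\<close> the kernel is the orthogonal complement of
  \<open>range (T\<^sup>*) = range T\<close>, so the space is the orthogonal sum of \<open>range T\<close> and \<open>ker T\<close>, both
  invariant under \<open>T\<close>. On the range \<open>T\<close> is bijective, on the kernel it is zero, and \<open>T\<^sup>\<dagger>\<close>
  inverts the first part and is zero on the second. In particular \<open>T T\<^sup>\<dagger> = T\<^sup>\<dagger> T\<close>. If
  \<open>A T = S A\<close>, then \<open>A\<close> maps \<open>range T\<close> into \<open>range S\<close> and \<open>ker T\<close> into \<open>ker S\<close>; it intertwines
  the two bijections, hence also their inverses. Algebraically, with commuting \<open>T\<close> and \<open>T\<^sup>\<dagger>\<close>,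
  this reads \<open>A T\<^sup>\<dagger> = A T T\<^sup>\<dagger> T\<^sup>\<dagger> = S\<^sup>\<dagger> S S A T\<^sup>\<dagger> T\<^sup>\<dagger> = S\<^sup>\<dagger> A T T\<^sup>\<dagger>\<close>, while
  \<open>S\<^sup>\<dagger> A (1 - T T\<^sup>\<dagger>) = 0\<close>.

  The analytic work lies in showing that \<open>T\<^sup>\<dagger>\<close> exists, is bounded and commutes with \<open>T\<close>
  (\<open>EP_mp_inverse_exists\<close>). Orthogonal projections onto closed subspaces give the Riesz
  representation theorem and hence a genuine adjoint (\<open>cinner_cadjoint\<close>), which identifies the
  kernel. Boundedness of \<open>T\<^sup>\<dagger>\<close> is the estimate \<open>norm u \<le> c * norm (T u)\<close> on the range
  (\<open>EP_bounded_below_on_range\<close>), obtained from uniform boundedness.\<close>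

section \<open>Complex inner products\<close>

lemma cinner_add_right: "cinner x (y + z) = cinner x y + cinner x (z::'a::complex_inner)"
  by (metis cinner_commute cinner_add_left complex_cnj_add)

lemma cinner_scaleC_right: "cinner x (a *\<^sub>C y) = cnj a * cinner x (y::'a::complex_inner)"
  by (metis cinner_commute cinner_scaleC_left complex_cnj_mult)

lemma cinner_diff_left: "cinner (x - y) z = cinner x z - cinner y (z::'a::complex_inner)"
  using cinner_add_left[of "x - y" y z] by (simp add: algebra_simps)

lemma cinner_diff_right: "cinner x (y - z) = cinner x y - cinner x (z::'a::complex_inner)"
  using cinner_add_right[of x "y - z" z] by (simp add: algebra_simps)

lemma cinner_zero_left [simp]: "cinner 0 (z::'a::complex_inner) = 0"
  using cinner_diff_left[of z z z] by simp

lemma cinner_zero_right [simp]: "cinner (z::'a::complex_inner) 0 = 0"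
  using cinner_diff_right[of z z z] by simp

lemma cinner_eq_zero_commute: "cinner x y = 0 \<longleftrightarrow> cinner y (x::'a::complex_inner) = 0"
  by (metis cinner_commute complex_cnj_zero)

lemma cinner_self: "cinner x (x::'a::complex_inner) = complex_of_real ((norm x)\<^sup>2)"
proof -
  have "Im (cinner x x) = 0"
    using arg_cong[OF cinner_commute[of x x], of Im] by simp
  then show ?thesis
    by (simp add: complex_eq_iff norm_eq_sqrt_cinner cinner_ge_zero)
qed

lemma norm_squared_cinner: "(norm x)\<^sup>2 = Re (cinner x (x::'a::complex_inner))"
  by (simp add: cinner_self)

lemma scaleC_minus_one: "(-1) *\<^sub>C x = - (x::'a::complex_vector)"
  using scaleR_scaleC[of "-1" x] by simp

text \<open>Subtracting from \<open>x\<close> its component along \<open>y\<close> lowers the squared norm by exactly the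
  squared length of that component. Both the Cauchy-Schwarz inequality and the orthogonality of
  a nearest point rest on this identity.\<close>

lemma norm_diff_component:
  fixes x y :: "'a::complex_inner"
  assumes "y \<noteq> 0"
  shows "(norm (x - (cinner x y / cinner y y) *\<^sub>C y))\<^sup>2
           = (norm x)\<^sup>2 - (cmod (cinner x y))\<^sup>2 / (norm y)\<^sup>2"
proof -
  define c where "c = cinner x y / cinner y y"
  have yy: "cinner y y \<noteq> 0" using assms by (simp add: cinner_eq_zero_iff)
  have orth: "cinner (x - c *\<^sub>C y) y = 0"
    using yy by (simp add: c_def cinner_diff_left cinner_scaleC_left)
  have "cinner (x - c *\<^sub>C y) (x - c *\<^sub>C y) = cinner (x - c *\<^sub>C y) x"
    using orth by (simp add: cinner_diff_right cinner_scaleC_right)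
  also have "\<dots> = cinner x x - cinner x y * cnj (cinner x y) / cinner y y"
    by (simp add: cinner_diff_left cinner_scaleC_left c_def cinner_commute[of y x])
  also have "\<dots> = complex_of_real ((norm x)\<^sup>2 - (cmod (cinner x y))\<^sup>2 / (norm y)\<^sup>2)"
    by (simp add: cinner_self complex_norm_square[symmetric])
  finally show ?thesis
    unfolding c_def norm_squared_cinner[of "x - _"] by simp
qed

lemma Cauchy_Schwarz_cinner: "cmod (cinner x y) \<le> norm x * norm (y::'a::complex_inner)"
proof (cases "y = 0")
  case False
  have "(cmod (cinner x y))\<^sup>2 / (norm y)\<^sup>2 \<le> (norm x)\<^sup>2"
    using norm_diff_component[OF False, of x]
      zero_le_power2[of "norm (x - (cinner x y / cinner y y) *\<^sub>C y)"] by linarith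
  then have "(cmod (cinner x y))\<^sup>2 \<le> (norm x * norm y)\<^sup>2"
    using False by (simp add: divide_le_eq power_mult_distrib)
  then show ?thesis by (rule power2_le_imp_le) simp
qed simp

lemma parallelogram_law_cinner:
  fixes x y :: "'a::complex_inner"
  shows "(norm (x + y))\<^sup>2 + (norm (x - y))\<^sup>2 = 2 * (norm x)\<^sup>2 + 2 * (norm y)\<^sup>2"
  by (simp add: norm_squared_cinner cinner_add_left cinner_add_right cinner_diff_left
      cinner_diff_right)

lemma bounded_linear_cinner_right: "bounded_linear (cinner (x::'a::complex_inner))"
proof (rule bounded_linear_intro[where K = "norm x"])
  show "cinner x (r *\<^sub>R y) = r *\<^sub>R cinner x y" for r y
    by (simp add: scaleR_scaleC cinner_scaleC_right scaleR_conv_of_real)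
qed (use Cauchy_Schwarz_cinner[of x] in \<open>auto simp: cinner_add_right mult.commute\<close>)


section \<open>Orthogonal projection onto a closed subspace\<close>

definition csubspace :: "'a::complex_vector set \<Rightarrow> bool" where
  "csubspace M \<longleftrightarrow> 0 \<in> M \<and> (\<forall>x\<in>M. \<forall>y\<in>M. x + y \<in> M) \<and> (\<forall>c. \<forall>x\<in>M. c *\<^sub>C x \<in> M)"

lemma csubspace_diff: "csubspace M \<Longrightarrow> x \<in> M \<Longrightarrow> y \<in> M \<Longrightarrow> x - y \<in> M"
  unfolding csubspace_def by (metis scaleC_minus_one uminus_add_conv_diff add.commute)

text \<open>A minimizing sequence is Cauchy: the midpoint of two almost nearest points of a subspace is
  no nearer than the infimum, and the parallelogram law then bounds their distance.\<close>

lemma nearest_point_exists: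
  fixes M :: "'a::chilbert_space set"
  assumes "closed M" "csubspace M"
  shows "\<exists>p\<in>M. \<forall>m\<in>M. norm (x - p) \<le> norm (x - m)"
proof -
  have ne: "M \<noteq> {}" using assms(2) by (auto simp: csubspace_def)
  define d where "d = infdist x M"
  have d_le: "d \<le> norm (x - m)" if "m \<in> M" for m
    using infdist_le[OF that, of x] by (simp add: d_def dist_norm)
  have d0: "0 \<le> d" by (simp add: d_def infdist_nonneg)
  have "\<exists>m\<in>M. norm (x - m) < d + inverse (Suc n)" for n
  proof -
    have "(INF a\<in>M. dist x a) < d + inverse (Suc n)"
      using ne by (simp add: d_def infdist_def)
    then show ?thesis
      using cInf_lessD[of "dist x ` M"] ne by (auto simp: dist_norm)
  qed
  then obtain s where sM: "s n \<in> M" and s: "norm (x - s n) < d + inverse (Suc n)" for n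
    by metis
  have mid: "(norm (s i - s j))\<^sup>2 \<le> 2 * (norm (x - s i))\<^sup>2 + 2 * (norm (x - s j))\<^sup>2 - 4 * d\<^sup>2"
    for i j
  proof -
    define m where "m = (1/2) *\<^sub>R (s i + s j)"
    have "m \<in> M"
      using assms(2) sM unfolding m_def csubspace_def scaleR_scaleC by blast
    then have "d\<^sup>2 \<le> (norm (x - m))\<^sup>2" using d_le d0 by (simp add: power_mono)
    moreover have "(x - s i) + (x - s j) = 2 *\<^sub>R (x - m)"
      by (simp add: m_def algebra_simps scaleR_2)
    then have "(norm ((x - s i) + (x - s j)))\<^sup>2 = 4 * (norm (x - m))\<^sup>2"
      by (simp add: power_mult_distrib)
    moreover have "norm ((x - s i) - (x - s j)) = norm (s i - s j)"
      by (simp add: norm_minus_commute)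
    ultimately show ?thesis
      using parallelogram_law_cinner[of "x - s i" "x - s j"] by simp
  qed
  have conv: "(\<lambda>n. norm (x - s n)) \<longlonglongrightarrow> d"
  proof (rule tendsto_sandwich[of "\<lambda>_. d" _ _ "\<lambda>n. d + inverse (real (Suc n))"])
    show "(\<lambda>n. d + inverse (real (Suc n))) \<longlonglongrightarrow> d"
      using tendsto_add[OF tendsto_const[of d] LIMSEQ_inverse_real_of_nat] by simp
  qed (use d_le[OF sM] less_imp_le[OF s] in \<open>auto intro!: always_eventually\<close>)
  have "Cauchy s"
  proof (rule CauchyI)
    fix e :: real assume "0 < e"
    have "(\<lambda>n. (norm (x - s n))\<^sup>2) \<longlonglongrightarrow> d\<^sup>2"
      using conv by (intro tendsto_intros)
    moreover have "d\<^sup>2 < d\<^sup>2 + e\<^sup>2 / 4" using \<open>0 < e\<close> by simp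
    ultimately have "\<forall>\<^sub>F n in sequentially. (norm (x - s n))\<^sup>2 < d\<^sup>2 + e\<^sup>2 / 4"
      by (rule order_tendstoD(2))
    then obtain N where N: "\<And>n. n \<ge> N \<Longrightarrow> (norm (x - s n))\<^sup>2 < d\<^sup>2 + e\<^sup>2 / 4"
      by (auto simp: eventually_sequentially)
    have "norm (s i - s j) < e" if "i \<ge> N" "j \<ge> N" for i j
    proof -
      have "(norm (s i - s j))\<^sup>2 < e\<^sup>2"
        using mid[of i j] N[OF that(1)] N[OF that(2)] by linarith
      then show ?thesis using \<open>0 < e\<close> by (simp add: power2_less_imp_less)
    qed
    then show "\<exists>N. \<forall>i\<ge>N. \<forall>j\<ge>N. norm (s i - s j) < e" by blast
  qed
  then obtain p where p: "s \<longlonglongrightarrow> p" using convergent_eq_Cauchy by blast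
  have "p \<in> M" using closed_sequentially[OF assms(1)] sM p by blast
  moreover have "(\<lambda>n. norm (x - s n)) \<longlonglongrightarrow> norm (x - p)" using p by (intro tendsto_intros)
  then have "norm (x - p) = d" using conv LIMSEQ_unique by blast
  ultimately show ?thesis using d_le by blast
qed

text \<open>The nearest point works: if the residual had a component along some \<open>m\<close> of the subspace,
  moving the point by this component would bring it closer.\<close>

theorem orthogonal_projection_exists:
  fixes M :: "'a::chilbert_space set"
  assumes "closed M" "csubspace M"
  shows "\<exists>p\<in>M. \<forall>m\<in>M. cinner (x - p) m = 0"
proof -
  obtain p where "p \<in> M" and p: "\<And>m. m \<in> M \<Longrightarrow> norm (x - p) \<le> norm (x - m)"
    using nearest_point_exists[OF assms] by blast
  have "cinner (x - p) m = 0" if "m \<in> M" for m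
  proof (cases "m = 0")
    case False
    define c where "c = cinner (x - p) m / cinner m m"
    have "p + c *\<^sub>C m \<in> M"
      using assms(2) \<open>p \<in> M\<close> that by (simp add: csubspace_def)
    from p[OF this] have "(norm (x - p))\<^sup>2 \<le> (norm (x - p - c *\<^sub>C m))\<^sup>2"
      by (simp add: algebra_simps power_mono)
    then have "(cmod (cinner (x - p) m))\<^sup>2 / (norm m)\<^sup>2 \<le> 0"
      using norm_diff_component[OF False, of "x - p"] by (simp add: c_def)
    then show ?thesis using False by (simp add: divide_le_0_iff)
  qed simp
  with \<open>p \<in> M\<close> show ?thesis by blast
qed


section \<open>Riesz representation and the adjoint\<close>

text \<open>A nonzero functional is a multiple of the inner product with a vector orthogonal to its
  kernel, and the projection onto the kernel supplies such a vector.\<close>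

theorem Riesz_representation:
  fixes f :: "'a::chilbert_space \<Rightarrow> complex"
  assumes f: "bounded_linear f" and homog: "\<And>c x. f (c *\<^sub>C x) = c * f x"
  shows "\<exists>z. \<forall>x. f x = cinner x z"
proof (cases "\<forall>x. f x = 0")
  case True
  then show ?thesis by (intro exI[of _ 0]) simp
next
  case False
  interpret bounded_linear f by (rule f)
  let ?K = "{x. f x = 0}"
  have "closed ?K" by (intro closed_Collect_eq continuous_intros continuous_on)
  moreover have "csubspace ?K" by (simp add: csubspace_def add homog)
  moreover obtain a where "f a \<noteq> 0" using False by blast
  ultimately obtain p where "f p = 0" and p: "\<And>m. f m = 0 \<Longrightarrow> cinner (a - p) m = 0"
    using orthogonal_projection_exists[of ?K a] by auto
  define q where "q = a - p"
  have fq: "f q \<noteq> 0" using \<open>f a \<noteq> 0\<close> \<open>f p = 0\<close> by (simp add: q_def diff)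
  have qq: "cinner q q \<noteq> 0" using fq zero by (auto simp: cinner_eq_zero_iff)
  \<comment> \<open>The kernel has codimension one, so \<open>f\<close> is determined by its value at the normal vector \<open>q\<close>.\<close>
  have "f x = cinner x (cnj (f q / cinner q q) *\<^sub>C q)" for x
  proof -
    have "f (x - (f x / f q) *\<^sub>C q) = 0" using fq by (simp add: diff homog)
    then have "cinner (x - (f x / f q) *\<^sub>C q) q = 0"
      using p cinner_eq_zero_commute unfolding q_def by blast
    then have "cinner x q = f x / f q * cinner q q"
      by (simp add: cinner_diff_left cinner_scaleC_left)
    then show ?thesis using fq qq by (simp add: cinner_scaleC_right)
  qed
  then show ?thesis by blast
qed

lemma adjoint_unique:
  fixes T :: "'a::complex_inner \<Rightarrow> 'a"
  assumes "\<forall>x y. cinner (T x) y = cinner x (U y)" "\<forall>x y. cinner (T x) y = cinner x (V y)"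
  shows "U = V"
proof
  fix y
  have "cinner (U y - V y) (U y - V y) = 0"
    using assms by (metis cinner_diff_right right_minus_eq)
  then show "U y = V y" by (simp add: cinner_eq_zero_iff)
qed

lemma cadjoint_eqI:
  assumes "\<And>x y. cinner (T x) y = cinner x (U y)"
  shows "cadjoint T = U"
  unfolding cadjoint_def using assms adjoint_unique[of T _ U] by (intro the_equality) auto

text \<open>Riesz representation of \<open>x \<mapsto> cinner (T x) y\<close> produces the value of the adjoint at \<open>y\<close>, so
  the definite description defining \<open>cadjoint\<close> denotes the adjoint of every bounded \<open>T\<close>.\<close>

lemma cinner_cadjoint:
  fixes T :: "'a::chilbert_space \<Rightarrow> 'a"
  assumes "bounded_clinear T"
  shows "cinner (T x) y = cinner x (cadjoint T y)"
proof -
  interpret bounded_clinear T by (rule assms)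
  have "\<exists>z. \<forall>x. cinner (T x) y = cinner x z" for y
  proof (rule Riesz_representation)
    have "bounded_linear (\<lambda>x. cnj (cinner y (T x)))"
      by (intro bounded_linear_compose[OF bounded_linear_cnj]
          bounded_linear_compose[OF bounded_linear_cinner_right] bounded_linear_axioms)
    then show "bounded_linear (\<lambda>x. cinner (T x) y)"
      by (simp add: cinner_commute[symmetric])
    show "cinner (T (c *\<^sub>C x)) y = c * cinner (T x) y" for c x
      by (simp add: scaleC cinner_scaleC_left)
  qed
  then obtain U where "\<And>x y. cinner (T x) y = cinner x (U y)" by metis
  moreover from this have "cadjoint T = U" by (rule cadjoint_eqI)
  ultimately show ?thesis by simp
qed


section \<open>Uniform boundedness\<close>

text \<open>By Baire's theorem one of the closed sets
  \<open>{y. \<forall>x\<in>U. cmod (cinner x y) \<le> n}\<close> contains a ball. Differences of points of that ball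
  fill a ball around the origin, on which all \<open>x \<in> U\<close> are then bounded simultaneously.\<close>

theorem weakly_bounded_imp_bounded:
  fixes U :: "'a::chilbert_space set"
  assumes "\<And>y. \<exists>B. \<forall>x\<in>U. cmod (cinner x y) \<le> B"
  shows "bounded U"
proof -
  define F where "F n = (\<Inter>x\<in>U. {y. cmod (cinner x y) \<le> real n})" for n :: nat
  have clF: "closed (F n)" for n
    unfolding F_def
    by (intro closed_INT ballI closed_Collect_le continuous_intros
        bounded_linear.continuous_on[OF bounded_linear_cinner_right])
  have "\<exists>n. y \<in> F n" for y
  proof -
    obtain B where B: "\<forall>x\<in>U. cmod (cinner x y) \<le> B" using assms by blast
    obtain n where "B \<le> real n" using real_arch_simple by blast
    then have "y \<in> F n" using B by (auto simp: F_def intro: order_trans)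
    then show ?thesis by blast
  qed
  then have cover: "\<Union>(range F) = UNIV" by blast
  have "\<exists>n. interior (F n) \<noteq> {}"
  proof (rule ccontr)
    assume "\<not> ?thesis"
    then have "Met_TC.mtopology interior_of \<Union>(range F) = {}"
      using clF by (intro Met_TC.metric_Baire_category_alt) (auto simp: complete_UNIV)
    with cover show False by simp
  qed
  then obtain n y0 r where "r > 0" and ball: "ball y0 r \<subseteq> F n"
    by (meson all_not_in_conv mem_interior)
  have "norm x \<le> 4 * real n / r" if "x \<in> U" for x
  proof (cases "x = 0")
    case False
    \<comment> \<open>The multiple of \<open>x\<close> of length \<open>r / 2\<close>: parallel to \<open>x\<close>, so \<open>cinner x v\<close> recovers \<open>norm x\<close>.\<close>
    define v where "v = (r / (2 * norm x)) *\<^sub>R x"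
    have "norm v < r" using \<open>r > 0\<close> False by (simp add: v_def)
    then have "y0 + v \<in> F n" "y0 \<in> F n"
      using ball \<open>r > 0\<close> by (auto simp: dist_norm)
    then have "cmod (cinner x (y0 + v)) \<le> n" "cmod (cinner x y0) \<le> n"
      using that by (auto simp: F_def)
    then have "cmod (cinner x v) \<le> 2 * n"
      using norm_triangle_ineq4[of "cinner x (y0 + v)" "cinner x y0"]
      by (simp add: cinner_add_right)
    moreover have "cmod (cinner x v) = r / 2 * norm x"
      using False \<open>r > 0\<close>
      by (simp add: v_def scaleR_scaleC cinner_scaleC_right cinner_self norm_mult norm_divide
          power2_eq_square)
    ultimately show ?thesis using \<open>r > 0\<close> by (simp add: field_simps)
  qed (use \<open>r > 0\<close> in simp)
  then show ?thesis unfolding bounded_iff by blast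
qed


section \<open>The Moore-Penrose inverse of an EP operator\<close>

lemma csubspace_range:
  assumes "bounded_clinear T" shows "csubspace (range T)"
proof -
  interpret bounded_clinear T by (rule assms)
  show ?thesis
    unfolding csubspace_def by (auto simp: image_iff) (metis zero, metis add, metis scaleC)
qed

text \<open>The kernel of any bounded operator is the orthogonal complement of the range of its adjoint,
  which for an EP operator is its own range.\<close>

lemma EP_kernel_iff:
  assumes "EP_operator T"
  shows "T k = 0 \<longleftrightarrow> (\<forall>m\<in>range T. cinner k m = 0)"
proof -
  have T: "bounded_clinear T" and R: "range T = range (cadjoint T)"
    using assms by (auto simp: EP_operator_def)
  have "(\<forall>m\<in>range T. cinner k m = 0) \<longleftrightarrow> (\<forall>y. cinner (T k) y = 0)"
    unfolding R by (simp add: cinner_cadjoint[OF T])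
  also have "\<dots> \<longleftrightarrow> T k = 0" by (metis cinner_eq_zero_iff cinner_zero_left)
  finally show ?thesis by simp
qed

lemma EP_range_kernel_decomposition:
  assumes "EP_operator T"
  obtains p where "p \<in> range T" "T (x - p) = 0"
proof -
  have "closed (range T)" "csubspace (range T)"
    using assms csubspace_range unfolding EP_operator_def by blast+
  then show ?thesis
    using orthogonal_projection_exists[of "range T" x] EP_kernel_iff[OF assms] that by blast
qed

text \<open>The vectors \<open>u\<close> of the range with \<open>norm (T u) \<le> 1\<close> form a weakly bounded set: any \<open>y\<close> is
  a vector \<open>T\<^sup>* z\<close> of \<open>range (T\<^sup>*) = range T\<close> plus one orthogonal to the range, so
  \<open>cinner u y = cinner (T u) z\<close> has modulus at most \<open>norm z\<close>. Uniform boundedness makes this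
  set bounded, and scaling gives the estimate.\<close>

lemma EP_bounded_below_on_range:
  assumes "EP_operator T"
  obtains c where "\<And>u. u \<in> range T \<Longrightarrow> norm u \<le> c * norm (T u)"
proof -
  have T: "bounded_clinear T" and R: "range T = range (cadjoint T)"
    using assms by (auto simp: EP_operator_def)
  interpret bounded_clinear T by (rule T)
  define U where "U = {u \<in> range T. norm (T u) \<le> 1}"
  have "bounded U"
  proof (rule weakly_bounded_imp_bounded)
    fix y
    obtain p where "p \<in> range T" "T (y - p) = 0"
      using EP_range_kernel_decomposition[OF assms] .
    then obtain z where z: "p = cadjoint T z" using R by auto
    have "cmod (cinner u y) \<le> norm z" if "u \<in> U" for u
    proof -
      have "u \<in> range T" and Tu: "norm (T u) \<le> 1" using that by (auto simp: U_def)
      have "cinner (y - p) u = 0"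
        using EP_kernel_iff[OF assms] \<open>T (y - p) = 0\<close> \<open>u \<in> range T\<close> by blast
      then have "cinner u (y - p) = 0" using cinner_eq_zero_commute by blast
      then have "cinner u y = cinner (T u) z"
        by (simp add: cinner_diff_right z cinner_cadjoint[OF T])
      also have "cmod \<dots> \<le> norm (T u) * norm z" by (rule Cauchy_Schwarz_cinner)
      also have "\<dots> \<le> norm z" using Tu by (simp add: mult_left_le_one_le)
      finally show ?thesis .
    qed
    then show "\<exists>B. \<forall>u\<in>U. cmod (cinner u y) \<le> B" by blast
  qed
  then obtain c where c: "\<And>u. u \<in> U \<Longrightarrow> norm u \<le> c" unfolding bounded_iff by blast
  have "norm u \<le> c * norm (T u)" if "u \<in> range T" for u
  proof (cases "T u = 0")
    case True
    then have "cinner u u = 0" using EP_kernel_iff[OF assms] that by blast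
    then show ?thesis using True by (simp add: cinner_eq_zero_iff)
  next
    case False
    define a where "a = inverse (norm (T u))"
    have "a *\<^sub>R u \<in> range T"
      using csubspace_range[OF T] that unfolding csubspace_def scaleR_scaleC by blast
    then have "a *\<^sub>R u \<in> U" using False by (simp add: U_def a_def scaleR)
    from c[OF this] show ?thesis using False by (simp add: a_def field_simps)
  qed
  with that show ?thesis .
qed

text \<open>The products \<open>TX\<close> and \<open>XT\<close> are determined by \<open>T\<close>: self-adjointness turns
  \<open>TX = (TY)(TX)\<close> into \<open>TX = (TX)(TY) = TY\<close>, and likewise \<open>XT = YT\<close>. Then
  \<open>X = (XT)X = Y(TX) = YTY = Y\<close>.\<close>

lemma mp_inverse_unique:
  fixes T :: "'a::chilbert_space \<Rightarrow> 'a"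
  assumes T: "bounded_clinear T" and X: "is_mp_inverse T X" and Y: "is_mp_inverse T Y"
  shows "X = Y"
proof -
  have comp: "bounded_clinear (\<lambda>x. f (g x))"
    if "bounded_clinear f" "bounded_clinear g" for f g :: "'a \<Rightarrow> 'a"
  proof -
    interpret f: bounded_clinear f by fact
    interpret g: bounded_clinear g by fact
    interpret fg: bounded_linear "\<lambda>x. f (g x)"
      by (rule bounded_linear_compose[OF f.bounded_linear_axioms g.bounded_linear_axioms])
    show ?thesis by unfold_locales (simp add: f.scaleC g.scaleC)
  qed
  have sa: "cinner (f x) y = cinner x (f y)"
    if "bounded_clinear f" "f = cadjoint f" for f :: "'a \<Rightarrow> 'a" and x y
    using cinner_cadjoint[OF that(1)] that(2) by metis
  have bX: "bounded_clinear X" and bY: "bounded_clinear Y"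
    using X Y by (auto simp: is_mp_inverse_def)
  have saTX: "cinner (T (X x)) y = cinner x (T (X y))" for x y
    using sa[of "T \<circ> X"] comp[OF T bX] X by (simp add: is_mp_inverse_def o_def)
  have saTY: "cinner (T (Y x)) y = cinner x (T (Y y))" for x y
    using sa[of "T \<circ> Y"] comp[OF T bY] Y by (simp add: is_mp_inverse_def o_def)
  have saXT: "cinner (X (T x)) y = cinner x (X (T y))" for x y
    using sa[of "X \<circ> T"] comp[OF bX T] X by (simp add: is_mp_inverse_def o_def)
  have saYT: "cinner (Y (T x)) y = cinner x (Y (T y))" for x y
    using sa[of "Y \<circ> T"] comp[OF bY T] Y by (simp add: is_mp_inverse_def o_def)
  have TXT: "T (X (T x)) = T x" and XTX: "X (T (X x)) = X x"
    and TYT: "T (Y (T x)) = T x" and YTY: "Y (T (Y x)) = Y x" for x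
    using X Y by (auto simp: is_mp_inverse_def fun_eq_iff)
  have TXY: "(\<lambda>x. T (X x)) = (\<lambda>x. T (Y x))"
  proof (rule adjoint_unique)
    show "\<forall>x y. cinner (T (X x)) y = cinner x (T (X y))" using saTX by blast
    have "cinner (T (X x)) y = cinner x (T (Y y))" for x y
    proof -
      have "cinner (T (Y (T (X x)))) y = cinner x (T (X (T (Y y))))" by (simp only: saTX saTY)
      then show ?thesis by (simp only: TXT TYT)
    qed
    then show "\<forall>x y. cinner (T (X x)) y = cinner x (T (Y y))" by blast
  qed
  have XYT: "(\<lambda>x. X (T x)) = (\<lambda>x. Y (T x))"
  proof (rule adjoint_unique)
    show "\<forall>x y. cinner (X (T x)) y = cinner x (X (T y))" using saXT by blast
    have "cinner (X (T x)) y = cinner x (Y (T y))" for x y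
    proof -
      have "cinner (X (T (Y (T x)))) y = cinner x (Y (T (X (T y))))" by (simp only: saXT saYT)
      then show ?thesis by (simp only: TXT TYT)
    qed
    then show "\<forall>x y. cinner (X (T x)) y = cinner x (Y (T y))" by blast
  qed
  have "X x = Y x" for x
    by (metis XTX YTY fun_cong[OF TXY] fun_cong[OF XYT])
  then show ?thesis by blast
qed

text \<open>\<open>T\<close> restricts to a bijection of its range, and the Moore-Penrose inverse is the inverse of
  this bijection after the orthogonal projection onto the range.\<close>

lemma EP_mp_inverse_exists:
  assumes EP: "EP_operator T"
  shows "\<exists>X. is_mp_inverse T X \<and> (\<forall>x. T (X x) = X (T x))"
proof -
  have T: "bounded_clinear T" using EP by (auto simp: EP_operator_def)
  interpret bounded_clinear T by (rule T)
  let ?R = "range T"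
  have R: "csubspace ?R" by (rule csubspace_range[OF T])
  obtain c where c: "\<And>u. u \<in> ?R \<Longrightarrow> norm u \<le> c * norm (T u)"
    using EP_bounded_below_on_range[OF EP] by blast
  have "\<exists>u\<in>?R. T (x - T u) = 0" for x
  proof -
    obtain v where v: "T (x - T v) = 0"
      using EP_range_kernel_decomposition[OF EP, of x] by auto
    obtain u where "u \<in> ?R" "T (v - u) = 0"
      using EP_range_kernel_decomposition[OF EP, of v] .
    with v show ?thesis by (auto simp: diff)
  qed
  then obtain X where XR: "X x \<in> ?R" and TX: "T (x - T (X x)) = 0" for x
    by metis
  \<comment> \<open>Since \<open>T\<close> is injective on its range, \<open>X x\<close> is the only \<open>u\<close> in the range for which \<open>T u\<close> is
    the projection of \<open>x\<close>. Linearity of \<open>X\<close> and all equations below follow from this.\<close>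
  have inj: "u = v" if "u \<in> ?R" "v \<in> ?R" "T (x - T u) = 0" "T (x - T v) = 0" for u v x
  proof -
    have "norm (T (u - v)) \<le> c * norm (T (T (u - v)))" by (rule c) blast
    also have "\<dots> = 0" using that by (simp add: diff)
    finally have "T (u - v) = 0" by simp
    then show ?thesis using c[OF csubspace_diff[OF R that(1,2)]] by simp
  qed
  have TTX: "T (T (X x)) = T x" for x using TX[of x] by (simp add: diff)
  have XI: "X x = u" if "u \<in> ?R" "T (T u) = T x" for x u
    using inj[of "X x" u x] that XR TX by (simp add: diff)
  have Xadd: "X (x + y) = X x + X y" for x y
    by (intro XI) (use R XR in \<open>unfold csubspace_def, blast\<close>, simp add: add TTX)
  have Xscale: "X (a *\<^sub>C x) = a *\<^sub>C X x" for a x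
    by (intro XI) (use R XR in \<open>unfold csubspace_def, blast\<close>, simp add: scaleC TTX)
  have orth: "cinner (x - T (X x)) (T v) = 0" for x v
    using EP_kernel_iff[OF EP] TX by blast
  have contr: "norm (T (X x)) \<le> norm x" for x
  proof -
    have "cinner x (T (X x)) = cinner (T (X x)) (T (X x))"
      using orth[of x "X x"] by (simp add: cinner_diff_left)
    then have "(norm (T (X x)))\<^sup>2 = cmod (cinner x (T (X x)))" by (simp add: cinner_self norm_power)
    also have "\<dots> \<le> norm x * norm (T (X x))" by (rule Cauchy_Schwarz_cinner)
    finally show ?thesis by (cases "T (X x) = 0") (auto simp: power2_eq_square)
  qed
  have bX: "bounded_clinear X"
  proof
    show "X (r *\<^sub>R x) = r *\<^sub>R X x" for r x by (simp add: scaleR_scaleC Xscale)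
    have "norm (X x) \<le> norm x * \<bar>c\<bar>" for x
    proof -
      have "norm (X x) \<le> c * norm (T (X x))" by (rule c[OF XR])
      also have "\<dots> \<le> \<bar>c\<bar> * norm x" by (intro mult_mono contr) auto
      finally show ?thesis by (simp add: mult.commute)
    qed
    then show "\<exists>K. \<forall>x. norm (X x) \<le> norm x * K" by blast
  qed (simp_all add: Xadd Xscale)
  have comm: "X (T x) = T (X x)" for x by (rule XI) (simp_all add: TTX)
  have sa: "cinner (T (X x)) y = cinner x (T (X y))" for x y
  proof -
    have "cinner (T (X x)) y = cinner (T (X x)) (T (X y))"
      using orth[of y "X x"] cinner_eq_zero_commute by (metis cinner_diff_right right_minus_eq)
    also have "\<dots> = cinner x (T (X y))"
      using orth[of x "X y"] by (simp add: cinner_diff_left)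
    finally show ?thesis .
  qed
  have "T \<circ> X = cadjoint (T \<circ> X)"
    by (rule cadjoint_eqI[symmetric]) (simp add: sa)
  moreover have "X \<circ> T = cadjoint (X \<circ> T)"
    by (rule cadjoint_eqI[symmetric]) (simp add: comm sa)
  moreover have "T \<circ> X \<circ> T = T" by (simp add: fun_eq_iff comm TTX)
  moreover have "X \<circ> T \<circ> X = X" by (simp add: fun_eq_iff XI[OF XR])
  ultimately have "is_mp_inverse T X" unfolding is_mp_inverse_def using bX by blast
  then show ?thesis using comm by auto
qed

lemma EP_mp_inverse:
  assumes "EP_operator T"
  shows "T (mp_inverse T x) = mp_inverse T (T x)"
    and "T (mp_inverse T (T x)) = T x"
    and "mp_inverse T (T (mp_inverse T x)) = mp_inverse T x"
    and "bounded_clinear (mp_inverse T)"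
proof -
  obtain X where X: "is_mp_inverse T X" and comm: "\<And>x. T (X x) = X (T x)"
    using EP_mp_inverse_exists[OF assms] by blast
  have eq: "mp_inverse T = X"
    unfolding mp_inverse_def using X assms mp_inverse_unique
    by (intro the_equality) (auto simp: EP_operator_def)
  have bX: "bounded_clinear X" and "T \<circ> X \<circ> T = T" "X \<circ> T \<circ> X = X"
    using X unfolding is_mp_inverse_def by blast+
  then have TXT: "T (X (T z)) = T z" and XTX: "X (T (X z)) = X z" for z
    by (simp_all add: fun_eq_iff)
  show "T (mp_inverse T x) = mp_inverse T (T x)" unfolding eq by (rule comm)
  show "T (mp_inverse T (T x)) = T x" unfolding eq by (rule TXT)
  show "mp_inverse T (T (mp_inverse T x)) = mp_inverse T x" unfolding eq by (rule XTX)
  show "bounded_clinear (mp_inverse T)" unfolding eq by (rule bX)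
qed

theorem theorem3p15:
  fixes T S A :: "'a::chilbert_space \<Rightarrow> 'a"
  assumes "EP_operator T"
    and "EP_operator S"
    and "bounded_clinear A"
    and "A \<circ> T = S \<circ> A"
  shows "A \<circ> mp_inverse T = mp_inverse S \<circ> A"
proof
  fix x
  let ?X = "mp_inverse T" and ?Y = "mp_inverse S"
  interpret A: bounded_clinear A by (rule assms)
  interpret T: bounded_clinear T using assms(1) by (simp add: EP_operator_def)
  interpret Y: bounded_clinear ?Y by (rule EP_mp_inverse(4)[OF assms(2)])
  note X = EP_mp_inverse[OF assms(1)] and Y = EP_mp_inverse[OF assms(2)]
  have AT: "A (T z) = S (A z)" for z using assms(4) by (simp add: fun_eq_iff)
  \<comment> \<open>The part of \<open>x\<close> in the range of \<open>T\<close>: \<open>A\<close> maps it into the range of \<open>S\<close>, where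
    \<open>S\<^sup>\<dagger> S\<close> is the identity.\<close>
  have "A (?X x) = A (T (?X (?X x)))" using X(1,3) by simp
  also have "\<dots> = ?Y (S (S (A (?X (?X x)))))" using Y(1,2) by (simp add: AT)
  also have "\<dots> = ?Y (A (T (T (?X (?X x)))))" by (simp add: AT)
  also have "\<dots> = ?Y (A (T (?X x)))" using X(1,3) by simp
  finally have range_part: "A (?X x) = ?Y (A (T (?X x)))" .
  \<comment> \<open>The part of \<open>x\<close> in the kernel of \<open>T\<close>: \<open>A\<close> maps it into the kernel of \<open>S\<close>, which \<open>S\<^sup>\<dagger>\<close>
    annihilates.\<close>
  define k where "k = x - T (?X x)"
  have "T k = 0" using X(1,2) by (simp add: k_def T.diff)
  then have "S (A k) = 0" using AT[of k] by (simp add: A.zero)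
  then have "?Y (A k) = 0" using Y(1,3) by (metis Y.zero)
  then have "?Y (A x) = ?Y (A (T (?X x)))" by (simp add: k_def A.diff Y.diff)
  with range_part show "(A \<circ> ?X) x = (?Y \<circ> A) x" by simp
qed

end
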